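(* Let $\mu\geqslant 0$, let $\beta_t\geqslant 0$ be a continuous function of $t>0$, and let $a_t\geqslant 0$ and $P_t=\begin{pmatrix}p^{(11)}_t&p^{(12)}_t\\ p^{(12)}_t&p^{(22)}_t\end{pmatrix}\succcurlyeq 0$ be continuously differentiable functions of time $t>0$. For $f\in\mathcal{F}_{\mu,\infty}$ on $\mathbf{R}^d$ with a minimizer $x_\star$, $f_\star=f(x_\star)$, and a trajectory $X_t$, put $$\mathcal{V}_{a_t,P_t}(X_t,t)=a_t\,(f(X_t)-f_\star)+\begin{pmatrix}X_t-x_\star\\ \dot X_t\end{pmatrix}^{\top}(P_t\otimes I_d)\begin{pmatrix}X_t-x_\star\\ \dot X_t\end{pmatrix}.$$ The following assertions are equivalent: (i) The inequality $\frac{d}{dt}\mathcal{V}_{a_t,P_t}(X_t,t)\leqslant 0$ is satisfied (for all $t>0$) for every dimension $d\in\mathbf{N}$, every function $f\in\mathcal{F}_{\mu,\infty}$ on $\mathbf{R}^d$ having a minimizer $x_\star$, and every trajectory $X_t$ generated by the non-autonomous second-order gradient flow $\ddot X_t+\beta_t\dot X_t+\nabla f(X_t)=0$. (ii) For all $t>0$ there exist $\lambda^{(1)}_t,\lambda^{(2)}_t\geqslant 0$ such that $$\begin{pmatrix}-\frac\mu2(\lambda^{(1)}_t+\lambda^{(2)}_t)+\dot p^{(11)}_t & p^{(11)}_t-\beta_t p^{(12)}_t+\dot p^{(12)}_t & -p^{(12)}_t+\frac{\lambda^{(1)}_t}{2}\\ p^{(11)}_t-\beta_t p^{(12)}_t+\dot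 p^{(12)}_t & 2\left(p^{(12)}_t-\beta_t p^{(22)}_t\right)+\dot p^{(22)}_t & -p^{(22)}_t+\frac{a_t}{2}\\ -p^{(12)}_t+\frac{\lambda^{(1)}_t}{2} & -p^{(22)}_t+\frac{a_t}{2} & 0\end{pmatrix}\preccurlyeq 0,\qquad \dot a_t=\lambda^{(1)}_t-\lambda^{(2)}_t .$$
   Context: $\mathcal{F}_{\mu,\infty}$ denotes the family of differentiable $\mu$-strongly convex functions $f:\mathbf{R}^d\to\mathbf{R}$ (merely convex if $\mu=0$), i.e. $f(x)\geqslant f(y)+\langle\nabla f(y),x-y\rangle+\frac{\mu}{2}\|x-y\|^2$ for all $x,y$; functions are assumed to have a minimizer $x_\star$. Trajectories are solutions of the ODE on $t>0$ (so that coefficients such as $\beta_t=3/t$ are allowed), with arbitrary position and velocity at a given positive time. A dot denotes the derivative with respect to $t$. $M\preccurlyeq 0$ (resp. $M\succcurlyeq 0$) means that the symmetric matrix $M$ is negative (resp. positive) semidefinite; $\otimes$ is the Kronecker product. *)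

theory Defs
  imports "HOL-Analysis.Analysis" "Jordan_Normal_Form.Matrix"
begin

text \<open>
  The dimension \<open>d\<close> is quantified inside the statement, so \<open>\<real>\<^sup>d\<close> cannot be a type.  It is rendered
  as \<^term>\<open>carrier_vec d :: real vec set\<close>; a function on \<open>\<real>\<^sup>d\<close> is a map \<open>real vec \<Rightarrow> real\<close> of which
  only the values on this carrier are ever used.  From here on the infix bullet is the scalar
  product and \<open>$\<close> the component of these vectors.
\<close>

unbundle no inner_syntax
unbundle no vec_syntax

definition eucl_norm :: "real vec \<Rightarrow> real" where
  "eucl_norm x = sqrt (x \<bullet> x)"

definition has_gradient :: "nat \<Rightarrow> (real vec \<Rightarrow> real) \<Rightarrow> real vec \<Rightarrow> real vec \<Rightarrow> bool" where
  "has_gradient d f g x \<longleftrightarrow> g \<in> carrier_vec d \<and>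
     (\<forall>\<epsilon>>0. \<exists>\<delta>>0. \<forall>h\<in>carrier_vec d. eucl_norm h < \<delta> \<longrightarrow>
        \<bar>f (x + h) - f x - g \<bullet> h\<bar> \<le> \<epsilon> * eucl_norm h)"

definition grad :: "nat \<Rightarrow> (real vec \<Rightarrow> real) \<Rightarrow> real vec \<Rightarrow> real vec" where
  "grad d f x = (THE g. has_gradient d f g x)"

lemma has_gradient_unique:
  assumes "has_gradient d f g x" and "has_gradient d f g' x"
  shows "g = g'"
proof (rule ccontr)
  assume ne: "g \<noteq> g'"
  define e where "e = g - g'"
  define n where "n = eucl_norm e"
  have c: "g \<in> carrier_vec d" "g' \<in> carrier_vec d" "e \<in> carrier_vec d"
    using assms by (auto simp: has_gradient_def e_def)
  have "dim_vec g = dim_vec g'" "dim_vec g' = d"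
    using c by auto
  then obtain i where i: "i < d" "g $ i \<noteq> g' $ i"
    using ne eq_vecI[of g' g] by metis
  then have "e $ i \<noteq> 0"
    using \<open>dim_vec g' = d\<close> by (simp add: e_def)
  have "(e $ i)\<^sup>2 \<le> (\<Sum>j\<in>{0..<d}. (e $ j)\<^sup>2)"
    using i by (intro member_le_sum) auto
  also have "\<dots> = e \<bullet> e"
    using c(3) by (simp add: scalar_prod_def power2_eq_square)
  finally have pos: "e \<bullet> e > 0"
    using zero_less_power2[of "e $ i"] \<open>e $ i \<noteq> 0\<close> by linarith
  then have n: "n > 0" "n * n = e \<bullet> e"
    by (simp_all add: n_def eucl_norm_def)
  then have n4: "n / 4 > 0" by simp
  from assms(1) n4 obtain \<delta> where \<delta>: "\<delta> > 0"
    "\<And>h. h \<in> carrier_vec d \<Longrightarrow> eucl_norm h < \<delta> \<Longrightarrow> \<bar>f (x + h) - f x - g \<bullet> h\<bar> \<le> n / 4 * eucl_norm h"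
    unfolding has_gradient_def by blast
  from assms(2) n4 obtain \<delta>' where \<delta>': "\<delta>' > 0"
    "\<And>h. h \<in> carrier_vec d \<Longrightarrow> eucl_norm h < \<delta>' \<Longrightarrow> \<bar>f (x + h) - f x - g' \<bullet> h\<bar> \<le> n / 4 * eucl_norm h"
    unfolding has_gradient_def by blast
  define s where "s = min \<delta> \<delta>' / (2 * n)"
  define h where "h = s \<cdot>\<^sub>v e"
  have s: "s > 0" using \<delta>(1) \<delta>'(1) n(1) by (simp add: s_def)
  have h: "h \<in> carrier_vec d" using c by (simp add: h_def)
  have "h \<bullet> h = (s * n) * (s * n)"
  proof -
    have "h \<bullet> h = s * (s * (e \<bullet> e))"
      using c by (simp add: h_def)
    then show ?thesis
      by (simp only: n(2)[symmetric] ac_simps)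
  qed
  then have nh: "eucl_norm h = s * n"
    using s n(1) by (simp add: eucl_norm_def)
  have "s * n = min \<delta> \<delta>' / 2" using n(1) by (simp add: s_def)
  then have "eucl_norm h < \<delta>" "eucl_norm h < \<delta>'"
    using \<delta>(1) \<delta>'(1) nh by auto
  then have "\<bar>g \<bullet> h - g' \<bullet> h\<bar> \<le> n / 4 * (s * n) + n / 4 * (s * n)"
    using \<delta>(2)[OF h] \<delta>'(2)[OF h] unfolding nh by linarith
  moreover have "g \<bullet> h - g' \<bullet> h = s * (n * n)"
  proof -
    have "g \<bullet> h - g' \<bullet> h = e \<bullet> h"
      using c h by (simp add: e_def minus_scalar_prod_distrib[of _ d])
    also have "\<dots> = s * (e \<bullet> e)"
      using c by (simp add: h_def)
    finally show ?thesis by (simp only: n(2))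
  qed
  ultimately show False
    using mult_pos_pos[OF s mult_pos_pos[OF n(1) n(1)]] by (simp add: ac_simps)
qed

lemma grad_eqI: "has_gradient d f g x \<Longrightarrow> grad d f x = g"
  unfolding grad_def using has_gradient_unique by blast

definition strongly_convex_functions :: "nat \<Rightarrow> real \<Rightarrow> (real vec \<Rightarrow> real) set" where
  "strongly_convex_functions d \<mu> =
     {f. (\<forall>x\<in>carrier_vec d. \<exists>g. has_gradient d f g x) \<and>
         (\<forall>x\<in>carrier_vec d. \<forall>y\<in>carrier_vec d.
            f x \<ge> f y + grad d f y \<bullet> (x - y) + \<mu> / 2 * (eucl_norm (x - y))\<^sup>2)}"

definition has_velocity :: "nat \<Rightarrow> (real \<Rightarrow> real vec) \<Rightarrow> real vec \<Rightarrow> real \<Rightarrow> bool" where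
  "has_velocity d X v t \<longleftrightarrow> v \<in> carrier_vec d \<and>
     (\<forall>i<d. ((\<lambda>s. X s $ i) has_real_derivative v $ i) (at t))"

text \<open>The argument \<open>V\<close> is the velocity, the time derivative of \<open>X\<close>, determined by \<open>X\<close> for \<open>t > 0\<close>.\<close>

definition gradient_flow_trajectory ::
  "nat \<Rightarrow> (real \<Rightarrow> real) \<Rightarrow> (real vec \<Rightarrow> real) \<Rightarrow> (real \<Rightarrow> real vec) \<Rightarrow> (real \<Rightarrow> real vec) \<Rightarrow> bool" where
  "gradient_flow_trajectory d \<beta> f X V \<longleftrightarrow>
     (\<forall>t>0. X t \<in> carrier_vec d \<and> has_velocity d X (V t) t \<and>
        (\<exists>A. has_velocity d V A t \<and> A + \<beta> t \<cdot>\<^sub>v V t + grad d f (X t) = 0\<^sub>v d))"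

definition kronecker_product :: "real mat \<Rightarrow> real mat \<Rightarrow> real mat" where
  "kronecker_product A B =
     mat (dim_row A * dim_row B) (dim_col A * dim_col B)
       (\<lambda>(i, j). A $$ (i div dim_row B, j div dim_col B) * B $$ (i mod dim_row B, j mod dim_col B))"

definition pos_semidef :: "real mat \<Rightarrow> bool" where
  "pos_semidef M \<longleftrightarrow> square_mat M \<and> transpose_mat M = M \<and>
     (\<forall>z\<in>carrier_vec (dim_row M). z \<bullet> (M *\<^sub>v z) \<ge> 0)"

definition neg_semidef :: "real mat \<Rightarrow> bool" where
  "neg_semidef M \<longleftrightarrow> square_mat M \<and> transpose_mat M = M \<and>
     (\<forall>z\<in>carrier_vec (dim_row M). z \<bullet> (M *\<^sub>v z) \<le> 0)"

definition lyapunov ::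
  "nat \<Rightarrow> (real \<Rightarrow> real) \<Rightarrow> (real \<Rightarrow> real mat) \<Rightarrow> (real vec \<Rightarrow> real) \<Rightarrow> real vec
    \<Rightarrow> real vec \<Rightarrow> real vec \<Rightarrow> real \<Rightarrow> real" where
  "lyapunov d a P f xs x v t =
     a t * (f x - f xs) +
     ((x - xs) @\<^sub>v v) \<bullet> (kronecker_product (P t) (1\<^sub>m d) *\<^sub>v ((x - xs) @\<^sub>v v))"

end

theory Submission
  imports Defs
begin

text \<open>
  Along a trajectory, with \<open>y = X - x\<^sub>\<star>\<close> and \<open>g = \<nabla>f X\<close>, the derivative of the Lyapunov function is
  \<open>a' (f X - f\<^sub>\<star>)\<close> plus a quadratic form in \<open>(y, V, g)\<close>.  If the matrix inequality holds, the multipliers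
  weight the two instances of strong convexity between \<open>X\<close> and \<open>x\<^sub>\<star>\<close>, and the derivative is bounded by
  the quadratic form of the matrix.

  Conversely, the zero in the corner of the matrix forces \<open>a = 2 p\<^sub>2\<^sub>2\<close> and \<open>\<lambda>\<^sub>1 = 2 p\<^sub>1\<^sub>2\<close>, so what must be
  shown is \<open>a = 2 p\<^sub>2\<^sub>2\<close>, \<open>0 \<le> p\<^sub>1\<^sub>2\<close>, \<open>a' \<le> 2 p\<^sub>1\<^sub>2\<close> and semidefiniteness of a \<open>2 \<times> 2\<close> matrix.  The functions
  \<open>\<mu> x\<^sup>2 / 2 + M \<psi> x\<close> in dimension one suffice, where \<open>\<psi>'\<close> is \<open>x - c\<close> clamped to \<open>[0, e]\<close>: \<open>M = 0\<close> yields
  the \<open>2 \<times> 2\<close> matrix, and \<open>M \<rightarrow> \<infinity>\<close>, then \<open>e \<rightarrow> 0\<close>, the rest.  Their gradients are Lipschitz, so by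
  Picard iteration a trajectory on all of \<open>t > 0\<close> passes through any prescribed state.
\<close>

subsection \<open>Global solutions of Lipschitz differential equations\<close>

text \<open>Lets theorems about compact intervals be applied on \<open>I\<close>, which is open and
  possibly unbounded.\<close>

lemma open_interval_enclosing:
  fixes I :: "real set"
  assumes "open I" "is_interval I" "s \<in> I" "t \<in> I"
  obtains a b where "a < s" "s < b" "a < t" "t < b" "{a..b} \<subseteq> I"
proof -
  obtain e where e: "e > 0" "cball (min s t) e \<subseteq> I"
    using assms(1,3,4) unfolding open_contains_cball by (metis min_def)
  obtain e' where e': "e' > 0" "cball (max s t) e' \<subseteq> I"
    using assms(1,3,4) unfolding open_contains_cball by (metis max_def)
  have "min s t - e \<in> I" "max s t + e' \<in> I"
    using e e' by (auto simp: subset_iff dist_real_def)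
  then have "{min s t - e..max s t + e'} \<subseteq> I"
    using assms(2) unfolding is_interval_1 by (meson atLeastAtMost_iff subsetI)
  then show thesis
    using e(1) e'(1) by (intro that[of "min s t - e" "max s t + e'"]) auto
qed

text \<open>The integral from \<open>t0\<close> is signed, because \<open>t\<close> may lie on
  either side of \<open>t0\<close>. Near \<open>t\<close> it differs only by a constant from the
  integral based at a point \<open>a\<close> to the left of both, and the fundamental theorem
  applies to the latter.\<close>

lemma antiderivative_open_interval:
  fixes u :: "real \<Rightarrow> 'a::banach"
  assumes I: "open I" "is_interval I" "t0 \<in> I" and u: "continuous_on I u"
  obtains U where "U t0 = 0" "\<And>t. t \<in> I \<Longrightarrow> (U has_vector_derivative u t) (at t)"
proof -
  define U where "U t = (if t0 \<le> t then integral {t0..t} u else - integral {t..t0} u)" for t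
  have "(U has_vector_derivative u t) (at t)" if "t \<in> I" for t
  proof -
    obtain a b where ab: "a < t0" "t0 < b" "a < t" "t < b" "{a..b} \<subseteq> I"
      using open_interval_enclosing[OF I(1,2,3) \<open>t \<in> I\<close>] by metis
    have cont: "continuous_on {a..b} u"
      using u ab(5) continuous_on_subset by blast
    have int: "u integrable_on {a..x}" if "x \<le> b" for x
      using that by (intro integrable_continuous_real continuous_on_subset[OF cont]) auto
    have U: "U s = integral {a..s} u - integral {a..t0} u" if "s \<in> {a<..<b}" for s
      using that ab(1,2) Henstock_Kurzweil_Integration.integral_combine[of a t0 s u]
        Henstock_Kurzweil_Integration.integral_combine[of a s t0 u] int[of s] int[of t0]
      by (auto simp: U_def algebra_simps)
    have "((\<lambda>s. integral {a..s} u) has_vector_derivative u t) (at t within {a..b})"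
      using cont ab by (intro integral_has_vector_derivative) auto
    then have "((\<lambda>s. integral {a..s} u) has_vector_derivative u t) (at t)"
      using ab at_within_interior[of t "{a..b}"] by simp
    then have "((\<lambda>s. integral {a..s} u - integral {a..t0} u) has_vector_derivative u t) (at t)"
      by (simp only: has_vector_derivative_diff_const)
    then show ?thesis
      by (rule has_vector_derivative_transform_within_open[where S = "{a<..<b}"]) (use ab U in auto)
  qed
  then show thesis
    by (intro that[of U]) (simp_all add: U_def)
qed

text \<open>Integration gains a factor \<open>1/2\<close> in the weight \<open>exp (2 \<bar>\<Lambda>\<bar>)\<close> on both sides of \<open>t0\<close>, so the Picard
  map is a contraction on the whole interval and no continuation of local solutions is needed.\<close>

lemma norm_bound_exp_weight:
  fixes D :: "real \<Rightarrow> 'a::real_normed_vector"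
  assumes I: "is_interval I" "t0 \<in> I" "t \<in> I"
    and \<Lambda>0: "\<Lambda> t0 = 0" and \<Lambda>: "\<And>s. s \<in> I \<Longrightarrow> (\<Lambda> has_real_derivative L s) (at s)"
    and L: "\<And>s. s \<in> I \<Longrightarrow> L s \<ge> 0"
    and D0: "D t0 = 0" and D: "\<And>s. s \<in> I \<Longrightarrow> (D has_vector_derivative d s) (at s)"
    and d: "\<And>s. s \<in> I \<Longrightarrow> norm (d s) \<le> L s * (c * exp (2 * \<bar>\<Lambda> s\<bar>))"
    and c: "c \<ge> 0"
  shows "norm (D t) \<le> c / 2 * exp (2 * \<bar>\<Lambda> t\<bar>)"
proof -
  have mono: "\<Lambda> x \<le> \<Lambda> y" if "x \<le> y" "{x..y} \<subseteq> I" for x y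
    using that(1)
  proof (rule DERIV_nonneg_imp_nondecreasing)
    fix s assume "x \<le> s" "s \<le> y"
    then have "s \<in> I" using that(2) by auto
    then show "\<exists>d. (\<Lambda> has_real_derivative d) (at s) \<and> 0 \<le> d" using \<Lambda> L by blast
  qed
  have cont: "continuous_on {x..y} D" "continuous_on {x..y} \<Lambda>" if "{x..y} \<subseteq> I" for x y
  proof -
    have "continuous_on I D" "continuous_on I \<Lambda>"
      using has_vector_derivative_continuous[OF D] DERIV_isCont[OF \<Lambda>]
      by (blast intro: continuous_at_imp_continuous_on)+
    then show "continuous_on {x..y} D" "continuous_on {x..y} \<Lambda>"
      using that continuous_on_subset by blast+
  qed
  have sub: "{x..y} \<subseteq> I" if "x \<in> I" "y \<in> I" for x y
    using I(1) that unfolding is_interval_1 by (meson atLeastAtMost_iff subsetI)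
  consider "t = t0" | "t0 < t" | "t < t0" by linarith
  then show ?thesis
  proof cases
    case 1
    then show ?thesis using D0 c by simp
  next
    case 2
    note S = sub[OF I(2,3)]
    \<comment> \<open>Mean value inequality with a comparison function: \<open>\<phi>\<close> is
      chosen so that its derivative is exactly the bound on \<open>norm (d s)\<close>.\<close>
    have "norm (D t - D t0) \<le> c / 2 * exp (2 * \<Lambda> t) - c / 2 * exp (2 * \<Lambda> t0)"
    proof (rule differentiable_bound_general[OF 2, where \<phi> = "\<lambda>s. c / 2 * exp (2 * \<Lambda> s)"
          and \<phi>' = "\<lambda>s. L s * (c * exp (2 * \<Lambda> s))" and f' = d])
      fix s assume s: "t0 < s" "s < t"
      then have sI: "s \<in> I" using S by auto
      show "(D has_vector_derivative d s) (at s)" using D sI .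
      show "((\<lambda>s. c / 2 * exp (2 * \<Lambda> s)) has_vector_derivative L s * (c * exp (2 * \<Lambda> s))) (at s)"
        unfolding has_real_derivative_iff_has_vector_derivative[symmetric]
        by (auto intro!: derivative_eq_intros \<Lambda>[OF sI])
      have "0 \<le> \<Lambda> s" using mono[of t0 s] sub[OF I(2) sI] s \<Lambda>0 by auto
      then show "norm (d s) \<le> L s * (c * exp (2 * \<Lambda> s))" using d[OF sI] by simp
    qed (auto intro!: continuous_intros cont[OF S])
    moreover have "0 \<le> \<Lambda> t" using mono[of t0 t] S 2 \<Lambda>0 by auto
    ultimately show ?thesis using D0 \<Lambda>0 c by simp
  next
    case 3
    note S = sub[OF I(3,2)]
    \<comment> \<open>Left of \<open>t0\<close> the function \<open>\<Lambda>\<close> is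
      nonpositive, so the weight is \<open>exp (- 2 * \<Lambda> s)\<close>; the minus sign in front
      keeps the comparison function nondecreasing.\<close>
    have "norm (D t0 - D t) \<le> (- c / 2 * exp (- 2 * \<Lambda> t0)) - (- c / 2 * exp (- 2 * \<Lambda> t))"
    proof (rule differentiable_bound_general[OF 3, where \<phi> = "\<lambda>s. - c / 2 * exp (- 2 * \<Lambda> s)"
          and \<phi>' = "\<lambda>s. L s * (c * exp (- 2 * \<Lambda> s))" and f' = d])
      fix s assume s: "t < s" "s < t0"
      then have sI: "s \<in> I" using S by auto
      show "(D has_vector_derivative d s) (at s)" using D sI .
      show "((\<lambda>s. - c / 2 * exp (- 2 * \<Lambda> s)) has_vector_derivative L s * (c * exp (- 2 * \<Lambda> s))) (at s)"
        unfolding has_real_derivative_iff_has_vector_derivative[symmetric]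
        by (auto intro!: derivative_eq_intros \<Lambda>[OF sI])
      have "\<Lambda> s \<le> 0" using mono[of s t0] sub[OF sI I(2)] s \<Lambda>0 by auto
      then show "norm (d s) \<le> L s * (c * exp (- 2 * \<Lambda> s))" using d[OF sI] by simp
    qed (auto intro!: continuous_intros cont[OF S])
    moreover have "\<Lambda> t \<le> 0" using mono[of t t0] S 3 \<Lambda>0 by auto
    ultimately show ?thesis using D0 \<Lambda>0 c by simp
  qed
qed

text \<open>Picard iteration started at the constant \<open>z0\<close>. The bound \<open>K\<close>
  may be unbounded near the ends of \<open>I\<close>; the weight \<open>E\<close> absorbs this, so
  consecutive iterates approach each other geometrically relative to \<open>E\<close> and the limit
  exists on all of \<open>I\<close> at once.\<close>

theorem picard_lindeloef_global:
  fixes h :: "real \<Rightarrow> 'a::banach \<Rightarrow> 'a"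
  assumes I: "open I" "is_interval I" "t0 \<in> I"
    and h: "continuous_on (I \<times> UNIV) (\<lambda>(t, z). h t z)"
    and K: "continuous_on I K"
    and lip: "\<And>t y z. t \<in> I \<Longrightarrow> norm (h t y - h t z) \<le> K t * norm (y - z)"
  obtains z where "z t0 = z0" "\<And>t. t \<in> I \<Longrightarrow> (z has_vector_derivative h t (z t)) (at t)"
proof -
  have comp: "continuous_on I (\<lambda>t. h t (w t))" if "continuous_on I w" for w
  proof -
    have "continuous_on I (\<lambda>t. (t, w t))"
      by (intro continuous_intros that)
    then have "continuous_on I (\<lambda>t. case (t, w t) of (t, z) \<Rightarrow> h t z)"
      by (rule continuous_on_compose2[OF h]) auto
    then show ?thesis by simp
  qed
  have solve: "\<exists>W. W t0 = z0 \<and> (\<forall>t\<in>I. (W has_vector_derivative h t (w t)) (at t))"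
    if w: "continuous_on I w" for w
  proof -
    obtain U where "U t0 = 0" "\<And>t. t \<in> I \<Longrightarrow> (U has_vector_derivative h t (w t)) (at t)"
      using antiderivative_open_interval[OF I comp[OF w]] by metis
    then show ?thesis
      by (intro exI[of _ "\<lambda>t. z0 + U t"]) (auto intro!: derivative_eq_intros)
  qed
  \<comment> \<open>Invariant for the dependent choice of the iterates: continuity allows the next
    iterate to be formed, and the last conjunct fixes the first one.\<close>
  define P where "P n w \<longleftrightarrow> continuous_on I w \<and> w t0 = z0 \<and> (n = 0 \<longrightarrow> w = (\<lambda>_. z0))"
    for n :: nat and w
  have "\<exists>z. \<forall>n. P n (z n) \<and> (\<forall>t\<in>I. (z (Suc n) has_vector_derivative h t (z n t)) (at t))"
  proof (rule dependent_nat_choice)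
    show "\<exists>w. P 0 w" by (simp add: P_def)
    fix w n assume "P n w"
    then obtain W where "W t0 = z0" "\<forall>t\<in>I. (W has_vector_derivative h t (w t)) (at t)"
      using solve unfolding P_def by blast
    moreover from this have "continuous_on I W"
      by (blast intro: continuous_at_imp_continuous_on has_vector_derivative_continuous)
    ultimately show "\<exists>W. P (Suc n) W \<and> (\<forall>t\<in>I. (W has_vector_derivative h t (w t)) (at t))"
      unfolding P_def by blast
  qed
  then obtain z where z_cont: "\<And>n. continuous_on I (z n)" and z_t0: "\<And>n. z n t0 = z0"
    and z_0: "z 0 = (\<lambda>_. z0)"
    and z_Suc: "\<And>n t. t \<in> I \<Longrightarrow> (z (Suc n) has_vector_derivative h t (z n t)) (at t)"
    unfolding P_def by metis
  \<comment> \<open>The first summand bounds the Lipschitz constant. The second bounds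
    \<open>h t z0\<close>, the derivative of the first iterate after the constant one, so the same
    weight also starts the induction.\<close>
  define L where "L t = \<bar>K t\<bar> + norm (h t z0)" for t
  have L: "L t \<ge> 0" for t by (simp add: L_def)
  have "continuous_on I L"
    unfolding L_def by (intro continuous_intros K comp)
  then obtain \<Lambda> where \<Lambda>0: "\<Lambda> t0 = 0"
    and \<Lambda>: "\<And>t. t \<in> I \<Longrightarrow> (\<Lambda> has_real_derivative L t) (at t)"
    using antiderivative_open_interval[OF I]
    unfolding has_real_derivative_iff_has_vector_derivative by metis
  define E where "E t = exp (2 * \<bar>\<Lambda> t\<bar>)" for t
  have lip': "norm (h t y - h t w) \<le> L t * r" if "t \<in> I" "norm (y - w) \<le> r" for t y w r
  proof -
    have "norm (h t y - h t w) \<le> K t * norm (y - w)" using lip that by blast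
    also have "\<dots> \<le> L t * norm (y - w)"
      using abs_ge_self[of "K t"] norm_ge_zero[of "h t z0"]
      unfolding L_def by (intro mult_right_mono norm_ge_zero) linarith
    also have "\<dots> \<le> L t * r" using that L by (intro mult_left_mono)
    finally show ?thesis .
  qed
  note weight = norm_bound_exp_weight[OF I(2,3) _ \<Lambda>0 \<Lambda> L, folded E_def]
  have step: "norm (z (Suc n) t - z n t) \<le> (1 / 2) ^ Suc n * E t" if "t \<in> I" for n t
    using that
  proof (induction n arbitrary: t)
    case 0
    have "norm (z (Suc 0) t - z0) \<le> 1 / 2 * E t"
    proof (rule weight[OF 0, where d = "\<lambda>s. h s z0"])
      fix s assume s: "s \<in> I"
      show "((\<lambda>t. z (Suc 0) t - z0) has_vector_derivative h s z0) (at s)"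
        using z_Suc[OF s, of 0] by (simp add: z_0 has_vector_derivative_diff_const)
      have "norm (h s z0) \<le> L s" by (simp add: L_def)
      also have "\<dots> \<le> L s * E s"
        using L[of s] by (intro mult_le_cancel_left1[THEN iffD2]) (auto simp: E_def)
      finally show "norm (h s z0) \<le> L s * (1 * E s)" by simp
    qed (simp_all add: z_t0)
    then show ?case by (simp add: z_0)
  next
    case (Suc n)
    have "norm (z (Suc (Suc n)) t - z (Suc n) t) \<le> (1 / 2) ^ Suc n / 2 * E t"
    proof (rule weight[OF Suc.prems, where d = "\<lambda>s. h s (z (Suc n) s) - h s (z n s)"])
      fix s assume s: "s \<in> I"
      show "((\<lambda>t. z (Suc (Suc n)) t - z (Suc n) t) has_vector_derivative
          h s (z (Suc n) s) - h s (z n s)) (at s)"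
        using z_Suc[OF s] by (intro has_vector_derivative_diff)
      show "norm (h s (z (Suc n) s) - h s (z n s)) \<le> L s * ((1 / 2) ^ Suc n * E s)"
        by (rule lip'[OF s Suc.IH[OF s]])
    qed (simp_all add: z_t0)
    then show ?case by simp
  qed
  have cauchy: "norm (z (n + k) t - z n t) \<le> ((1 / 2) ^ n - (1 / 2) ^ (n + k)) * E t"
    if "t \<in> I" for n k t
  proof (induction k)
    case (Suc k)
    have "norm (z (n + Suc k) t - z n t)
        \<le> norm (z (Suc (n + k)) t - z (n + k) t) + norm (z (n + k) t - z n t)"
      using norm_triangle_ineq[of "z (Suc (n + k)) t - z (n + k) t" "z (n + k) t - z n t"] by simp
    also have "\<dots> \<le> (1 / 2) ^ Suc (n + k) * E t + ((1 / 2) ^ n - (1 / 2) ^ (n + k)) * E t"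
      using step[OF that] Suc by (intro add_mono)
    also have "\<dots> = ((1 / 2) ^ n - (1 / 2) ^ (n + Suc k)) * E t"
      by (simp add: algebra_simps)
    finally show ?case .
  qed simp
  have E: "E t > 0" for t by (simp add: E_def)
  have cauchy': "norm (z m t - z n t) \<le> (1 / 2) ^ n * E t" if "t \<in> I" "m \<ge> n" for n m t
  proof -
    obtain k where "m = n + k" using \<open>m \<ge> n\<close> le_Suc_ex by blast
    with cauchy[OF \<open>t \<in> I\<close>, of n k] have "norm (z m t - z n t) \<le> ((1 / 2) ^ n - (1 / 2) ^ m) * E t"
      by simp
    also have "\<dots> \<le> (1 / 2) ^ n * E t"
      using E[of t] by (intro mult_right_mono) auto
    finally show ?thesis .
  qed
  have lim0: "(\<lambda>n. (1 / 2) ^ n * B) \<longlonglongrightarrow> 0" for B :: real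
    by (intro tendsto_mult_left_zero LIMSEQ_power_zero) simp
  have "\<exists>l. (\<lambda>n. z n t) \<longlonglongrightarrow> l" if "t \<in> I" for t
  proof -
    have "Cauchy (\<lambda>n. z n t)"
    proof (rule metric_CauchyI)
      fix e :: real assume "e > 0"
      then have "\<forall>\<^sub>F n in sequentially. (1 / 2) ^ n * (2 * E t) < e"
        using order_tendstoD(2)[OF lim0] by blast
      then obtain N where N: "(1 / 2) ^ N * (2 * E t) < e"
        by (auto simp: eventually_sequentially)
      have "dist (z m t) (z n t) < e" if "m \<ge> N" "n \<ge> N" for m n
        using dist_triangle2[of "z m t" "z n t" "z N t"] N cauchy'[OF \<open>t \<in> I\<close> that(1)]
          cauchy'[OF \<open>t \<in> I\<close> that(2)] by (simp add: dist_norm)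
      then show "\<exists>M. \<forall>m\<ge>M. \<forall>n\<ge>M. dist (z m t) (z n t) < e" by blast
    qed
    then show ?thesis using Cauchy_convergent convergent_def by blast
  qed
  then obtain Z where Z: "\<And>t. t \<in> I \<Longrightarrow> (\<lambda>n. z n t) \<longlonglongrightarrow> Z t" by metis
  have Z_le: "norm (Z t - z n t) \<le> (1 / 2) ^ n * E t" if "t \<in> I" for t n
  proof (rule tendsto_upperbound)
    show "(\<lambda>m. norm (z m t - z n t)) \<longlonglongrightarrow> norm (Z t - z n t)"
      by (intro tendsto_intros Z that)
    show "\<forall>\<^sub>F m in sequentially. norm (z m t - z n t) \<le> (1 / 2) ^ n * E t"
      using eventually_ge_at_top[of n] by eventually_elim (rule cauchy'[OF that])
  qed simp
  \<comment> \<open>\<open>E\<close> is bounded on a compact interval around \<open>t\<close>, so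
    the convergence there is uniform and the limit inherits continuity.\<close>
  have "continuous (at t) Z" if t: "t \<in> I" for t
  proof -
    obtain a b where ab: "a < t" "t < b" "{a..b} \<subseteq> I"
      using open_interval_enclosing[OF I(1,2) t t] by metis
    have "continuous_on {a..b} E"
      unfolding E_def using ab(3)
      by (auto intro!: continuous_intros continuous_at_imp_continuous_on DERIV_isCont[OF \<Lambda>])
    then obtain x where x: "\<And>s. s \<in> {a..b} \<Longrightarrow> E s \<le> E x"
      using continuous_attains_sup[of "{a..b}" E] ab by fastforce
    have "uniform_limit {a..b} z Z sequentially"
    proof (rule uniform_limitI)
      fix e :: real assume "e > 0"
      then have "\<forall>\<^sub>F n in sequentially. (1 / 2) ^ n * E x < e"
        using order_tendstoD(2)[OF lim0] by blast
      then show "\<forall>\<^sub>F n in sequentially. \<forall>s\<in>{a..b}. dist (z n s) (Z s) < e"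
      proof eventually_elim
        fix n assume n: "(1 / 2) ^ n * E x < e"
        show "\<forall>s\<in>{a..b}. dist (z n s) (Z s) < e"
        proof
          fix s assume s: "s \<in> {a..b}"
          have "norm (Z s - z n s) \<le> (1 / 2) ^ n * E s" using Z_le s ab(3) by blast
          also have "\<dots> \<le> (1 / 2) ^ n * E x" using x[OF s] by (intro mult_left_mono) auto
          finally show "dist (z n s) (Z s) < e" using n by (simp add: dist_norm norm_minus_commute)
        qed
      qed
    qed
    then have "continuous_on {a..b} Z"
      by (rule uniform_limit_theorem[rotated])
        (use ab(3) in \<open>auto intro!: always_eventually continuous_on_subset[OF z_cont]\<close>)
    then show ?thesis
      using ab by (intro continuous_on_interior) auto
  qed
  then have "continuous_on I Z"
    by (rule continuous_at_imp_continuous_on[OF ballI])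
  then obtain W where W0: "W t0 = z0"
    and W: "\<And>t. t \<in> I \<Longrightarrow> (W has_vector_derivative h t (Z t)) (at t)"
    using solve by metis
  \<comment> \<open>\<open>W\<close> is the Picard image of \<open>Z\<close>. The contraction
    estimate drives \<open>z (Suc n)\<close> to \<open>W\<close> as well, so \<open>Z\<close> is a
    fixed point by uniqueness of limits.\<close>
  have WZ: "W t = Z t" if "t \<in> I" for t
  proof -
    have "norm (W t - z (Suc n) t) \<le> (1 / 2) ^ n / 2 * E t" for n
    proof (rule weight[OF that, where d = "\<lambda>s. h s (Z s) - h s (z n s)"])
      fix s assume s: "s \<in> I"
      show "((\<lambda>t. W t - z (Suc n) t) has_vector_derivative h s (Z s) - h s (z n s)) (at s)"
        using z_Suc[OF s] W[OF s] by (intro has_vector_derivative_diff)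
      show "norm (h s (Z s) - h s (z n s)) \<le> L s * ((1 / 2) ^ n * E s)"
        by (rule lip'[OF s Z_le[OF s]])
    qed (simp_all add: z_t0 W0)
    then have le: "\<forall>n. norm (z (Suc n) t - W t) \<le> (1 / 2) ^ n * (E t / 2)"
      by (simp add: norm_minus_commute)
    have "(\<lambda>n. z (Suc n) t - W t) \<longlonglongrightarrow> 0"
      by (rule Lim_null_comparison[OF always_eventually[OF le] lim0])
    then have "(\<lambda>n. z (Suc n) t) \<longlonglongrightarrow> W t"
      by (rule Lim_null[THEN iffD2])
    then show ?thesis
      using Z[OF that] LIMSEQ_Suc LIMSEQ_unique by blast
  qed
  show thesis
  proof (rule that[of W])
    fix t assume "t \<in> I"
    then show "(W has_vector_derivative h t (W t)) (at t)" using W WZ by simp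
  qed (rule W0)
qed

text \<open>The equation becomes a first order system for the pair of position and velocity. Its
  Lipschitz bound \<open>1 + \<bar>\<beta> t\<bar> + C\<close> must depend on \<open>t\<close>,
  since \<open>\<beta>\<close> may blow up at 0, as 3/t does.\<close>

lemma damped_oscillator_solution:
  fixes \<beta> G :: "real \<Rightarrow> real"
  assumes \<beta>: "continuous_on {0<..} \<beta>" and lip: "\<And>x y. \<bar>G x - G y\<bar> \<le> C * \<bar>x - y\<bar>" and t0: "t0 > 0"
  obtains x v where "x t0 = x0" "v t0 = v0"
    "\<And>t. t > 0 \<Longrightarrow> (x has_real_derivative v t) (at t)"
    "\<And>t. t > 0 \<Longrightarrow> (v has_real_derivative - \<beta> t * v t - G (x t)) (at t)"
proof -
  define h where "h t z = (snd z, - \<beta> t * snd z - G (fst z))" for t and z :: "real \<times> real"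
  have C: "C \<ge> 0" using lip[of 1 0] abs_ge_zero[of "G 1 - G 0"] by simp
  have "continuous_on UNIV G"
    using C lip by (intro lipschitz_on_continuous_on[of C] lipschitz_onI) (auto simp: dist_real_def)
  then have "continuous_on ({0<..} \<times> UNIV) (\<lambda>p. G (fst (snd p)))"
    by (rule continuous_on_compose2) (auto intro!: continuous_intros)
  moreover have "continuous_on ({0<..} \<times> UNIV) (\<lambda>p. \<beta> (fst p))"
    by (rule continuous_on_compose2[OF \<beta>]) (auto intro!: continuous_intros)
  ultimately have cont: "continuous_on ({0<..} \<times> UNIV) (\<lambda>(t, z). h t z)"
    unfolding h_def case_prod_beta by (intro continuous_intros)
  have lip_h: "norm (h t y - h t z) \<le> (1 + \<bar>\<beta> t\<bar> + C) * norm (y - z)" for t y z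
  proof -
    have "norm (h t y - h t z) \<le> \<bar>snd (h t y - h t z)\<bar> + \<bar>fst (h t y - h t z)\<bar>"
      unfolding norm_prod_def by (rule order_trans[OF sqrt_sum_squares_le_sum_abs]) simp
    also have "\<dots> = \<bar>- (\<beta> t * snd (y - z)) - (G (fst y) - G (fst z))\<bar> + \<bar>snd (y - z)\<bar>"
      by (simp add: h_def algebra_simps)
    also have "\<dots> \<le> \<bar>\<beta> t\<bar> * \<bar>snd (y - z)\<bar> + C * \<bar>fst (y - z)\<bar> + \<bar>snd (y - z)\<bar>"
      using lip[of "fst y" "fst z"] abs_triangle_ineq4[of "- (\<beta> t * snd (y - z))" "G (fst y) - G (fst z)"]
      by (simp add: abs_mult)
    also have "\<dots> \<le> \<bar>\<beta> t\<bar> * norm (y - z) + C * norm (y - z) + norm (y - z)"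
      using C norm_fst_le[of "fst (y - z)" "snd (y - z)"] norm_snd_le[of "snd (y - z)" "fst (y - z)"]
      unfolding prod.collapse real_norm_def by (intro add_mono mult_left_mono abs_ge_zero)
    finally show ?thesis by (simp add: algebra_simps)
  qed
  have "continuous_on {0<..} (\<lambda>t. 1 + \<bar>\<beta> t\<bar> + C)"
    by (intro continuous_intros \<beta>)
  then obtain z where z0: "z t0 = (x0, v0)"
    and z: "\<And>t. t > 0 \<Longrightarrow> (z has_vector_derivative h t (z t)) (at t)"
    using picard_lindeloef_global[OF _ _ _ cont _ lip_h, of t0 "(x0, v0)"] t0
    by (auto simp: is_interval_def)
  show thesis
  proof (rule that[of "\<lambda>t. fst (z t)" "\<lambda>t. snd (z t)"])
    fix t :: real assume "t > 0"
    from z[OF this] have z': "(z has_derivative (\<lambda>r. r *\<^sub>R h t (z t))) (at t)"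
      by (simp add: has_vector_derivative_def)
    show "((\<lambda>t. fst (z t)) has_real_derivative snd (z t)) (at t)"
      using has_derivative_fst[OF z'] by (simp add: has_field_derivative_def h_def mult_commute_abs)
    show "((\<lambda>t. snd (z t)) has_real_derivative - \<beta> t * snd (z t) - G (fst (z t))) (at t)"
      using has_derivative_snd[OF z'] by (simp add: has_field_derivative_def h_def mult_commute_abs)
  qed (simp_all add: z0)
qed

subsection \<open>Derivatives along a trajectory\<close>

lemma eucl_norm_sq: "(eucl_norm x)\<^sup>2 = x \<bullet> x"
  by (simp add: eucl_norm_def scalar_prod_def sum_nonneg)

text \<open>Product rule coordinate by coordinate. The scalar product sums over the dimension of its
  right factor, so \<open>Y\<close> has to lie in the carrier on a neighbourhood of
  \<open>t\<close>, not only at \<open>t\<close>.\<close>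

lemma scalar_prod_has_derivative:
  assumes S: "open S" "t \<in> S" "\<And>s. s \<in> S \<Longrightarrow> Y s \<in> carrier_vec d"
    and X: "has_velocity d X v t" and Y: "has_velocity d Y w t"
  shows "((\<lambda>s. X s \<bullet> Y s) has_real_derivative v \<bullet> Y t + X t \<bullet> w) (at t)"
proof -
  have "((\<lambda>s. \<Sum>i\<in>{0..<d}. X s $ i * Y s $ i) has_real_derivative
      (\<Sum>i\<in>{0..<d}. X t $ i * w $ i + v $ i * Y t $ i)) (at t)"
    using X Y by (intro DERIV_sum DERIV_mult') (auto simp: has_velocity_def)
  also have "(\<Sum>i\<in>{0..<d}. X t $ i * w $ i + v $ i * Y t $ i) = v \<bullet> Y t + X t \<bullet> w"
    using Y S(3)[OF S(2)] by (auto simp: scalar_prod_def has_velocity_def sum.distrib)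
  finally show ?thesis
    by (rule has_field_derivative_transform_within_open[where S = S])
      (use S in \<open>auto simp: scalar_prod_def dest: S(3)\<close>)
qed

text \<open>Chain rule for the hand-made gradient. The difference quotient splits into a linear part
  tending to \<open>g \<bullet> v\<close> and a remainder that is small relative to
  \<open>eucl_norm (h s)\<close>; as \<open>eucl_norm (h s) / \<bar>s - t\<bar>\<close> converges,
  the remainder vanishes in the limit.\<close>

lemma has_derivative_along_curve:
  assumes g: "has_gradient d f g (X t)" and X: "has_velocity d X v t"
    and S: "open S" "t \<in> S" "\<And>s. s \<in> S \<Longrightarrow> X s \<in> carrier_vec d"
  shows "((\<lambda>s. f (X s)) has_real_derivative g \<bullet> v) (at t)"
proof -
  define h where "h s = X s - X t" for s
  have Xt: "X t \<in> carrier_vec d" and v: "v \<in> carrier_vec d"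
    using S X by (auto simp: has_velocity_def)
  have h: "h s \<in> carrier_vec d" "X t + h s = X s" if "s \<in> S" for s
    using S(3)[OF that] Xt unfolding h_def by auto
  have quot: "((\<lambda>s. (X s $ i - X t $ i) / (s - t)) \<longlongrightarrow> v $ i) (at t)" if "i < d" for i
    using X that unfolding has_velocity_def has_field_derivative_iff by blast
  have ev: "\<forall>\<^sub>F s in at t. s \<in> S \<and> s \<noteq> t"
    using eventually_at_in_open[OF S(1,2)] by (auto elim: eventually_mono)
  have "((\<lambda>s. \<Sum>i\<in>{0..<d}. g $ i * ((X s $ i - X t $ i) / (s - t)))
      \<longlongrightarrow> (\<Sum>i\<in>{0..<d}. g $ i * v $ i)) (at t)"
    by (intro tendsto_intros quot) auto
  moreover have "\<forall>\<^sub>F s in at t. (\<Sum>i\<in>{0..<d}. g $ i * ((X s $ i - X t $ i) / (s - t)))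
      = g \<bullet> h s / (s - t)"
    using ev by eventually_elim
      (use Xt in \<open>auto simp: scalar_prod_def h_def sum_divide_distrib dest: S(3)\<close>)
  ultimately have lin: "((\<lambda>s. g \<bullet> h s / (s - t)) \<longlongrightarrow> g \<bullet> v) (at t)"
    using v by (simp add: scalar_prod_def Lim_transform_eventually)
  have "((\<lambda>s. sqrt (\<Sum>i\<in>{0..<d}. ((X s $ i - X t $ i) / (s - t))\<^sup>2))
      \<longlongrightarrow> sqrt (\<Sum>i\<in>{0..<d}. (v $ i)\<^sup>2)) (at t)"
    by (intro tendsto_intros quot) auto
  moreover have "\<forall>\<^sub>F s in at t. sqrt (\<Sum>i\<in>{0..<d}. ((X s $ i - X t $ i) / (s - t))\<^sup>2)
      = eucl_norm (h s) / \<bar>s - t\<bar>"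
    using ev
  proof eventually_elim
    case (elim s)
    have "eucl_norm (h s) = sqrt (\<Sum>i\<in>{0..<d}. (X s $ i - X t $ i)\<^sup>2)"
      using elim Xt S(3)[of s]
      by (auto simp: eucl_norm_def scalar_prod_def h_def power2_eq_square)
    then show ?case
      by (simp add: power_divide sum_divide_distrib[symmetric] real_sqrt_divide)
  qed
  ultimately have nrm: "((\<lambda>s. eucl_norm (h s) / \<bar>s - t\<bar>) \<longlongrightarrow> eucl_norm v) (at t)"
    using v by (simp add: eucl_norm_def scalar_prod_def power2_eq_square Lim_transform_eventually)
  have "((\<lambda>s. eucl_norm (h s) / \<bar>s - t\<bar> * \<bar>s - t\<bar>) \<longlongrightarrow> eucl_norm v * \<bar>t - t\<bar>) (at t)"
    by (intro tendsto_intros nrm)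
  moreover have "\<forall>\<^sub>F s in at t. eucl_norm (h s) / \<bar>s - t\<bar> * \<bar>s - t\<bar> = eucl_norm (h s)"
    using ev by eventually_elim auto
  ultimately have small: "((\<lambda>s. eucl_norm (h s)) \<longlongrightarrow> 0) (at t)"
    by (simp add: Lim_transform_eventually)
  have rem: "((\<lambda>s. (f (X s) - f (X t) - g \<bullet> h s) / (s - t)) \<longlongrightarrow> 0) (at t)"
  proof (rule tendstoI)
    fix e :: real assume "e > 0"
    \<comment> \<open>Adding 1 makes \<open>N\<close> positive and strictly larger than the limit of
      \<open>eucl_norm (h s) / \<bar>s - t\<bar>\<close>, hence an eventual bound for it.\<close>
    define N where "N = eucl_norm v + 1"
    have N: "N > 0" by (simp add: N_def eucl_norm_def add_nonneg_pos scalar_prod_def sum_nonneg)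
    then have "e / (2 * N) > 0" using \<open>e > 0\<close> by simp
    then obtain \<delta> where \<delta>: "\<delta> > 0" "\<And>k. k \<in> carrier_vec d \<Longrightarrow> eucl_norm k < \<delta> \<Longrightarrow>
        \<bar>f (X t + k) - f (X t) - g \<bullet> k\<bar> \<le> e / (2 * N) * eucl_norm k"
      using g unfolding has_gradient_def by blast
    have "\<forall>\<^sub>F s in at t. eucl_norm (h s) < \<delta>"
      using order_tendstoD(2)[OF small \<delta>(1)] .
    moreover have "\<forall>\<^sub>F s in at t. eucl_norm (h s) / \<bar>s - t\<bar> < N"
      by (rule order_tendstoD(2)[OF nrm]) (simp add: N_def)
    ultimately show "\<forall>\<^sub>F s in at t. dist ((f (X s) - f (X t) - g \<bullet> h s) / (s - t)) 0 < e"
      using ev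
    proof eventually_elim
      case (elim s)
      have "\<bar>f (X s) - f (X t) - g \<bullet> h s\<bar> \<le> e / (2 * N) * eucl_norm (h s)"
        using \<delta>(2)[of "h s"] h[of s] elim by auto
      then have "\<bar>f (X s) - f (X t) - g \<bullet> h s\<bar> / \<bar>s - t\<bar> \<le> e / (2 * N) * (eucl_norm (h s) / \<bar>s - t\<bar>)"
        using divide_right_mono[of _ _ "\<bar>s - t\<bar>"] by fastforce
      also have "\<dots> \<le> e / (2 * N) * N"
        using elim N \<open>e > 0\<close> by (intro mult_left_mono) auto
      also have "\<dots> < e" using N \<open>e > 0\<close> by simp
      finally show ?case by (simp add: dist_real_def)
    qed
  qed
  have "((\<lambda>s. (f (X s) - f (X t) - g \<bullet> h s) / (s - t) + g \<bullet> h s / (s - t)) \<longlongrightarrow> 0 + g \<bullet> v) (at t)"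
    by (intro tendsto_add rem lin)
  then show ?thesis
    unfolding has_field_derivative_iff by (simp add: add_divide_distrib[symmetric])
qed

section \<open>Convexity inequalities at a minimizer\<close>

lemma has_gradient_grad:
  assumes "f \<in> strongly_convex_functions d \<mu>" "x \<in> carrier_vec d"
  shows "has_gradient d f (grad d f x) x"
  using assms grad_eqI unfolding strongly_convex_functions_def by blast

lemma grad_carrier [simp]:
  assumes "f \<in> strongly_convex_functions d \<mu>" "x \<in> carrier_vec d"
  shows "grad d f x \<in> carrier_vec d"
  using has_gradient_grad[OF assms] by (simp add: has_gradient_def)

text \<open>Along the line through \<open>xs\<close> in direction \<open>u\<close> this is the
  vanishing of the derivative of a one-variable function at a minimum.\<close>

lemma gradient_at_minimizer:
  assumes xs: "is_arg_min f (\<lambda>x. x \<in> carrier_vec d) xs" and g: "has_gradient d f g xs"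
    and u: "u \<in> carrier_vec d"
  shows "g \<bullet> u = 0"
proof -
  have xs_c: "xs \<in> carrier_vec d" and min: "\<And>x. x \<in> carrier_vec d \<Longrightarrow> f xs \<le> f x"
    using xs by (auto simp: is_arg_min_def not_less)
  have "has_velocity d (\<lambda>s. xs + s \<cdot>\<^sub>v u) u 0"
    using xs_c u by (auto simp: has_velocity_def intro!: derivative_eq_intros)
  moreover have "xs + 0 \<cdot>\<^sub>v u = xs" using xs_c u by auto
  ultimately have "((\<lambda>s. f (xs + s \<cdot>\<^sub>v u)) has_real_derivative g \<bullet> u) (at 0)"
    using g xs_c u by (intro has_derivative_along_curve[where S = UNIV and d = d]) auto
  then show ?thesis
    by (rule DERIV_local_min[where d = 1]) (use xs_c u min \<open>xs + 0 \<cdot>\<^sub>v u = xs\<close> in auto)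
qed

text \<open>The first bound is the strong convexity inequality based at \<open>x\<close> and
  evaluated at \<open>xs\<close>; the second is based at \<open>xs\<close>, where the gradient term
  vanishes. They are the inequalities that the two multipliers weight.\<close>

lemma strongly_convex_functions_minimizer_bounds:
  assumes f: "f \<in> strongly_convex_functions d \<mu>" and xs: "is_arg_min f (\<lambda>x. x \<in> carrier_vec d) xs"
    and x: "x \<in> carrier_vec d"
  shows "f x - f xs \<le> (x - xs) \<bullet> grad d f x - \<mu> / 2 * ((x - xs) \<bullet> (x - xs))"
    and "\<mu> / 2 * ((x - xs) \<bullet> (x - xs)) \<le> f x - f xs"
proof -
  have xs_c: "xs \<in> carrier_vec d" using xs by (simp add: is_arg_min_def)
  have conv: "f u \<ge> f w + grad d f w \<bullet> (u - w) + \<mu> / 2 * ((u - w) \<bullet> (u - w))"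
    if "u \<in> carrier_vec d" "w \<in> carrier_vec d" for u w
    using f that unfolding strongly_convex_functions_def eucl_norm_sq by blast
  define g where "g = grad d f x"
  have g: "g \<in> carrier_vec d" using f x by (simp add: g_def)
  have "g \<bullet> (xs - x) = - ((x - xs) \<bullet> g)" "(xs - x) \<bullet> (xs - x) = (x - xs) \<bullet> (x - xs)"
    using x xs_c g
    by (auto simp: scalar_prod_def sum_negf[symmetric] algebra_simps intro!: sum.cong)
  then show "f x - f xs \<le> (x - xs) \<bullet> grad d f x - \<mu> / 2 * ((x - xs) \<bullet> (x - xs))"
    using conv[OF xs_c x] by (simp add: g_def)
  have "grad d f xs \<bullet> (x - xs) = 0"
    using gradient_at_minimizer[OF xs has_gradient_grad[OF f xs_c]] x xs_c by simp
  then show "\<mu> / 2 * ((x - xs) \<bullet> (x - xs)) \<le> f x - f xs"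
    using conv[OF x xs_c] by simp
qed

section \<open>The derivative of the Lyapunov function\<close>

lemma kronecker_quadratic_form:
  assumes x: "x \<in> carrier_vec d" and v: "v \<in> carrier_vec d"
  shows "(x @\<^sub>v v) \<bullet> (kronecker_product (mat_of_rows_list 2 [[p, q], [q, r]]) (1\<^sub>m d) *\<^sub>v (x @\<^sub>v v))
    = p * (x \<bullet> x) + 2 * q * (x \<bullet> v) + r * (v \<bullet> v)"
proof -
  \<comment> \<open>With the identity as second factor, the quotient of an index by \<open>d\<close>
    selects the block and the remainder the position in it, so each block is a multiple of the
    identity.\<close>
  have "kronecker_product (mat_of_rows_list 2 [[p, q], [q, r]]) (1\<^sub>m d)
      = four_block_mat (p \<cdot>\<^sub>m 1\<^sub>m d) (q \<cdot>\<^sub>m 1\<^sub>m d) (q \<cdot>\<^sub>m 1\<^sub>m d) (r \<cdot>\<^sub>m 1\<^sub>m d)" (is "?K = ?B")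
  proof (rule eq_matI)
    have split: "k div d = (if k < d then 0 else 1)" "k mod d = (if k < d then k else k - d)"
      if "k < d + d" for k
      using that by (auto simp: div_nat_eqI mod_if)
    fix i j assume "i < dim_row ?B" "j < dim_col ?B"
    then show "?K $$ (i, j) = ?B $$ (i, j)"
      by (auto simp: kronecker_product_def mat_of_rows_list_def split)
  qed (auto simp: kronecker_product_def mat_of_rows_list_def)
  moreover have "?B *\<^sub>v (x @\<^sub>v v) = (p \<cdot>\<^sub>v x + q \<cdot>\<^sub>v v) @\<^sub>v (q \<cdot>\<^sub>v x + r \<cdot>\<^sub>v v)"
  proof -
    have one: "(k \<cdot>\<^sub>m 1\<^sub>m d) *\<^sub>v w = k \<cdot>\<^sub>v w" if "w \<in> carrier_vec d" for k and w :: "real vec"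
      using that by (intro eq_vecI) auto
    show ?thesis
      using x v by (subst four_block_mat_mult_vec[of _ d d _ d _ d]) (auto simp: one)
  qed
  ultimately show ?thesis
    using x v by (simp add: scalar_prod_append[of _ d _ d] scalar_prod_add_distrib[of _ d]
        comm_scalar_prod[of v d x] algebra_simps)
qed

text \<open>Product and chain rule, with the acceleration eliminated by the differential equation.
  Apart from the terms in the multipliers, the coefficients of the scalar products are those of the
  quadratic form of the matrix in the theorem, with cross terms counted twice.\<close>

lemma lyapunov_has_derivative:
  assumes f: "f \<in> strongly_convex_functions d \<mu>" and xs: "xs \<in> carrier_vec d"
    and traj: "gradient_flow_trajectory d \<beta> f X V" and t: "t > 0"
    and P: "\<And>t. t > 0 \<Longrightarrow> P t = mat_of_rows_list 2 [[p11 t, p12 t], [p12 t, p22 t]]"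
    and a: "(a has_real_derivative a') (at t)"
    and p11: "(p11 has_real_derivative p11') (at t)"
    and p12: "(p12 has_real_derivative p12') (at t)"
    and p22: "(p22 has_real_derivative p22') (at t)"
  defines "y \<equiv> X t - xs" and "g \<equiv> grad d f (X t)"
  shows "((\<lambda>s. lyapunov d a P f xs (X s) (V s) s) has_real_derivative
      a' * (f (X t) - f xs) + p11' * (y \<bullet> y) + 2 * (p11 t - \<beta> t * p12 t + p12') * (y \<bullet> V t)
      + (2 * (p12 t - \<beta> t * p22 t) + p22') * (V t \<bullet> V t)
      - 2 * p12 t * (y \<bullet> g) + (a t - 2 * p22 t) * (V t \<bullet> g)) (at t)" (is "(_ has_real_derivative ?D) _")
proof -
  define Y where "Y s = X s - xs" for s
  have X: "\<And>s. s > 0 \<Longrightarrow> X s \<in> carrier_vec d" "has_velocity d X (V t) t"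
    and V: "\<And>s. s > 0 \<Longrightarrow> V s \<in> carrier_vec d"
    using traj t unfolding gradient_flow_trajectory_def has_velocity_def by blast+
  obtain A where A: "has_velocity d V A t" and ode: "A + \<beta> t \<cdot>\<^sub>v V t + g = 0\<^sub>v d"
    using traj t unfolding gradient_flow_trajectory_def g_def by blast
  have Y: "\<And>s. s > 0 \<Longrightarrow> Y s \<in> carrier_vec d" "has_velocity d Y (V t) t"
    using X xs by (auto simp: Y_def has_velocity_def intro!: derivative_eq_intros)
  have Yt: "Y t = y" by (simp add: Y_def y_def)
  have c: "y \<in> carrier_vec d" "V t \<in> carrier_vec d" "A \<in> carrier_vec d" "g \<in> carrier_vec d"
    using Y(1)[OF t] V[OF t] A f X(1)[OF t] by (auto simp: Yt has_velocity_def g_def)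
  have accel: "u \<bullet> A = - \<beta> t * (u \<bullet> V t) - u \<bullet> g" if u: "u \<in> carrier_vec d" for u
  proof -
    have "u \<bullet> (A + \<beta> t \<cdot>\<^sub>v V t + g) = u \<bullet> A + \<beta> t * (u \<bullet> V t) + u \<bullet> g"
      using u c by (simp add: scalar_prod_add_distrib[of _ d])
    then show ?thesis using u by (simp add: ode)
  qed
  note S = open_greaterThan[of "0::real"]
  have tS: "t \<in> {0<..}" using t by simp
  have "((\<lambda>s. f (X s)) has_real_derivative g \<bullet> V t) (at t)"
    by (rule has_derivative_along_curve[OF _ X(2) S tS])
      (use has_gradient_grad[OF f X(1)[OF t]] X(1) in \<open>auto simp: g_def\<close>)
  moreover have "((\<lambda>s. Y s \<bullet> Y s) has_real_derivative V t \<bullet> Y t + Y t \<bullet> V t) (at t)"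
    by (rule scalar_prod_has_derivative[OF S tS _ Y(2) Y(2)]) (use Y in auto)
  moreover have "((\<lambda>s. Y s \<bullet> V s) has_real_derivative V t \<bullet> V t + Y t \<bullet> A) (at t)"
    by (rule scalar_prod_has_derivative[OF S tS _ Y(2) A]) (use V in auto)
  moreover have "((\<lambda>s. V s \<bullet> V s) has_real_derivative A \<bullet> V t + V t \<bullet> A) (at t)"
    by (rule scalar_prod_has_derivative[OF S tS _ A A]) (use V in auto)
  ultimately have "((\<lambda>s. a s * (f (X s) - f xs) + (p11 s * (Y s \<bullet> Y s) + 2 * p12 s * (Y s \<bullet> V s)
      + p22 s * (V s \<bullet> V s))) has_real_derivative ?D) (at t)"
    by (auto intro!: derivative_eq_intros a p11 p12 p22
        simp: Yt accel c comm_scalar_prod[OF c(3,2)] comm_scalar_prod[OF c(2,1)]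
          comm_scalar_prod[OF c(4,2)] algebra_simps)
  then show ?thesis
    by (rule has_field_derivative_transform_within_open[OF _ S tS])
      (use Y V in \<open>auto simp: lyapunov_def P kronecker_quadratic_form[folded Y_def] Y_def[symmetric]\<close>)
qed

subsection \<open>Test functions in dimension one\<close>

lemma has_gradient_1:
  assumes "(\<phi> has_real_derivative g) (at (x $ 0))" and x: "x \<in> carrier_vec 1"
  shows "has_gradient 1 (\<lambda>x. \<phi> (x $ 0)) (vec 1 (\<lambda>_. g)) x"
  unfolding has_gradient_def
proof (intro conjI allI impI)
  fix e :: real assume e: "e > 0"
  have "(\<lambda>h. (\<phi> (x $ 0 + h) - \<phi> (x $ 0)) / h) \<midarrow>0\<rightarrow> g"
    using assms(1) by (simp add: DERIV_def)
  from LIM_D[OF this e] obtain \<delta> where \<delta>: "\<delta> > 0"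
    "\<And>h. h \<noteq> 0 \<Longrightarrow> \<bar>h\<bar> < \<delta> \<Longrightarrow> \<bar>(\<phi> (x $ 0 + h) - \<phi> (x $ 0)) / h - g\<bar> < e"
    unfolding real_norm_def diff_zero by blast
  have "\<bar>\<phi> ((x + h) $ 0) - \<phi> (x $ 0) - vec 1 (\<lambda>_. g) \<bullet> h\<bar> \<le> e * eucl_norm h"
    if h: "h \<in> carrier_vec 1" "eucl_norm h < \<delta>" for h
  proof -
    have n: "eucl_norm h = \<bar>h $ 0\<bar>" using h by (simp add: eucl_norm_def scalar_prod_def)
    have "\<bar>\<phi> (x $ 0 + h $ 0) - \<phi> (x $ 0) - g * h $ 0\<bar> \<le> e * \<bar>h $ 0\<bar>"
    proof (cases "h $ 0 = 0")
      case False
      have "\<phi> (x $ 0 + h $ 0) - \<phi> (x $ 0) - g * h $ 0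
          = ((\<phi> (x $ 0 + h $ 0) - \<phi> (x $ 0)) / h $ 0 - g) * h $ 0"
        using False by (simp add: field_simps)
      then show ?thesis
        using \<delta>(2)[OF False] h(2) n by (simp add: abs_mult mult_right_mono)
    qed simp
    then show ?thesis using h x n by (simp add: scalar_prod_def)
  qed
  then show "\<exists>\<delta>>0. \<forall>h\<in>carrier_vec 1. eucl_norm h < \<delta> \<longrightarrow>
      \<bar>\<phi> ((x + h) $ 0) - \<phi> (x $ 0) - vec 1 (\<lambda>_. g) \<bullet> h\<bar> \<le> e * eucl_norm h"
    using \<delta>(1) by blast
qed simp

lemma strongly_convex_functions_1:
  assumes G: "\<And>x. (\<phi> has_real_derivative G x) (at x)"
    and conv: "\<And>x y. \<phi> x \<ge> \<phi> y + G y * (x - y) + \<mu> / 2 * (x - y)\<^sup>2"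
  shows "(\<lambda>x. \<phi> (x $ 0)) \<in> strongly_convex_functions 1 \<mu>"
    and "x \<in> carrier_vec 1 \<Longrightarrow> grad 1 (\<lambda>x. \<phi> (x $ 0)) x = vec 1 (\<lambda>_. G (x $ 0))"
proof -
  have grad: "has_gradient 1 (\<lambda>x. \<phi> (x $ 0)) (vec 1 (\<lambda>_. G (x $ 0))) x" if "x \<in> carrier_vec 1" for x
    using has_gradient_1[OF G that] .
  then show "x \<in> carrier_vec 1 \<Longrightarrow> grad 1 (\<lambda>x. \<phi> (x $ 0)) x = vec 1 (\<lambda>_. G (x $ 0))"
    by (rule grad_eqI)
  show "(\<lambda>x. \<phi> (x $ 0)) \<in> strongly_convex_functions 1 \<mu>"
    unfolding strongly_convex_functions_def
  proof (intro CollectI conjI ballI)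
    fix x y :: "real vec" assume x: "x \<in> carrier_vec 1" and y: "y \<in> carrier_vec 1"
    show "\<phi> (y $ 0) + grad 1 (\<lambda>x. \<phi> (x $ 0)) y \<bullet> (x - y) + \<mu> / 2 * (eucl_norm (x - y))\<^sup>2 \<le> \<phi> (x $ 0)"
      using conv[of "y $ 0" "x $ 0"] x y
      unfolding grad_eqI[OF grad[OF y]] eucl_norm_sq by (simp add: scalar_prod_def power2_eq_square)
  qed (use grad in blast)
qed

text \<open>The clamp is the difference of the positive parts of \<open>x - c\<close> and
  \<open>x - c - e\<close>, and half the square of a positive part is an antiderivative of it. The
  clamp is nondecreasing, so \<open>\<psi>\<close> is convex and lies above its tangents.\<close>

lemma ramp_antiderivative:
  fixes c e :: real
  defines "\<psi> \<equiv> \<lambda>x. ((max 0 (x - c))\<^sup>2 - (max 0 (x - c - e))\<^sup>2) / 2"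
  assumes e: "e \<ge> 0"
  shows "(\<psi> has_real_derivative max 0 (min e (x - c))) (at x)"
    and "\<psi> x \<ge> \<psi> y + max 0 (min e (y - c)) * (x - y)"
proof -
  have sq: "((\<lambda>x. (max 0 x)\<^sup>2 / 2) has_real_derivative max 0 x) (at x)" for x :: real
  proof -
    consider "x < 0" | "x = 0" | "x > 0" by linarith
    then show ?thesis
    proof cases
      case 1
      have "((\<lambda>_. 0) has_real_derivative max 0 x) (at x)" using 1 by simp
      then show ?thesis
        by (rule has_field_derivative_transform_within_open[where S = "{..<0}"]) (use 1 in auto)
    next
      \<comment> \<open>At the kink the derivative is computed directly: the difference quotient is
        \<open>max 0 h / 2\<close>.\<close>
      case 2
      have "(\<lambda>h. max 0 h / 2) \<midarrow>0\<rightarrow> max 0 0 / (2::real)"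
        by (intro tendsto_intros) auto
      moreover have "(max 0 (0 + h))\<^sup>2 / 2 / h = max 0 h / 2" if "h \<noteq> 0" for h :: real
        using that by (auto simp: max_def power2_eq_square)
      ultimately show ?thesis
        using 2 unfolding DERIV_def by (auto elim!: Lim_transform_eventually simp: eventually_at_filter)
    next
      case 3
      have "((\<lambda>x. x\<^sup>2 / 2) has_real_derivative max 0 x) (at x)"
        using 3 by (auto intro!: derivative_eq_intros)
      then show ?thesis
        by (rule has_field_derivative_transform_within_open[where S = "{0<..}"]) (use 3 in auto)
    qed
  qed
  show D: "(\<psi> has_real_derivative max 0 (min e (x - c))) (at x)" for x
  proof -
    have "((\<lambda>x. (max 0 (x - c))\<^sup>2 / 2 - (max 0 (x - c - e))\<^sup>2 / 2) has_real_derivative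
        max 0 (x - c) * 1 - max 0 (x - c - e) * 1) (at x)"
      by (intro DERIV_diff DERIV_chain2[OF sq]) (auto intro!: derivative_eq_intros)
    moreover have "max 0 (x - c) * 1 - max 0 (x - c - e) * 1 = max 0 (min e (x - c))"
      using e by (auto simp: max_def min_def)
    ultimately show ?thesis by (simp add: \<psi>_def diff_divide_distrib)
  qed
  have "convex_on UNIV \<psi>"
    by (rule convex_on_realI[where f' = "\<lambda>x. max 0 (min e (x - c))"]) (auto simp: D)
  then have "max 0 (min e (y - c)) * (x - y) \<le> \<psi> x - \<psi> y"
    by (rule convex_on_imp_above_tangent) (use D in auto)
  then show "\<psi> x \<ge> \<psi> y + max 0 (min e (y - c)) * (x - y)" by simp
qed

text \<open>Dissipation along trajectories becomes an inequality at the single time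
  \<open>t\<close>: some trajectory has position \<open>x0\<close> and velocity \<open>v0\<close> at
  that time, so both are free real parameters. The minimizer is placed at the origin.\<close>

lemma lyapunov_inequality_1:
  fixes \<phi> G :: "real \<Rightarrow> real"
  assumes dec: "\<And>f xs X V t. f \<in> strongly_convex_functions 1 \<mu> \<Longrightarrow>
      is_arg_min f (\<lambda>x. x \<in> carrier_vec 1) xs \<Longrightarrow> gradient_flow_trajectory 1 \<beta> f X V \<Longrightarrow> t > 0 \<Longrightarrow>
      \<exists>D\<le>0. ((\<lambda>s. lyapunov 1 a P f xs (X s) (V s) s) has_real_derivative D) (at t)"
    and \<beta>: "continuous_on {0<..} \<beta>" and t: "t > 0"
    and P: "\<And>t. t > 0 \<Longrightarrow> P t = mat_of_rows_list 2 [[p11 t, p12 t], [p12 t, p22 t]]"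
    and a: "(a has_real_derivative a') (at t)"
    and p11: "(p11 has_real_derivative p11') (at t)"
    and p12: "(p12 has_real_derivative p12') (at t)"
    and p22: "(p22 has_real_derivative p22') (at t)"
    and G: "\<And>x. (\<phi> has_real_derivative G x) (at x)"
    and lip: "\<And>x y. \<bar>G x - G y\<bar> \<le> C * \<bar>x - y\<bar>"
    and conv: "\<And>x y. \<phi> x \<ge> \<phi> y + G y * (x - y) + \<mu> / 2 * (x - y)\<^sup>2"
    and min: "\<And>x. \<phi> 0 \<le> \<phi> x"
  shows "a' * (\<phi> x0 - \<phi> 0) + p11' * x0\<^sup>2 + 2 * (p11 t - \<beta> t * p12 t + p12') * (x0 * v0)
      + (2 * (p12 t - \<beta> t * p22 t) + p22') * v0\<^sup>2
      - 2 * p12 t * (x0 * G x0) + (a t - 2 * p22 t) * (v0 * G x0) \<le> 0"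
proof -
  obtain x v where xv: "x t = x0" "v t = v0"
    and x: "\<And>t. t > 0 \<Longrightarrow> (x has_real_derivative v t) (at t)"
    and v: "\<And>t. t > 0 \<Longrightarrow> (v has_real_derivative - \<beta> t * v t - G (x t)) (at t)"
    using damped_oscillator_solution[OF \<beta> lip t] by metis
  define f where "f y = \<phi> (y $ 0)" for y :: "real vec"
  define X where "X s = vec 1 (\<lambda>_. x s)" for s
  define V where "V s = vec 1 (\<lambda>_. v s)" for s
  note grad = strongly_convex_functions_1(2)[of \<phi> G, OF G conv, folded f_def]
  have f: "f \<in> strongly_convex_functions 1 \<mu>"
    using strongly_convex_functions_1(1)[of \<phi> G, OF G conv] by (simp add: f_def[abs_def])
  have xs: "is_arg_min f (\<lambda>x. x \<in> carrier_vec 1) (0\<^sub>v 1)"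
    using min by (auto simp: is_arg_min_def f_def not_less)
  have traj: "gradient_flow_trajectory 1 \<beta> f X V"
    unfolding gradient_flow_trajectory_def
  proof (intro allI impI conjI)
    fix s :: real assume s: "s > 0"
    show "X s \<in> carrier_vec 1" by (simp add: X_def)
    show "has_velocity 1 X (V s) s"
      using x[OF s] by (simp add: has_velocity_def X_def V_def)
    have "has_velocity 1 V (vec 1 (\<lambda>_. - \<beta> s * v s - G (x s))) s"
      using v[OF s] by (simp add: has_velocity_def V_def)
    moreover have "vec 1 (\<lambda>_. - \<beta> s * v s - G (x s)) + \<beta> s \<cdot>\<^sub>v V s + grad 1 f (X s) = 0\<^sub>v 1"
    proof -
      have "grad 1 f (X s) = vec 1 (\<lambda>_. G (x s))"
        by (subst grad) (simp_all add: X_def)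
      then show ?thesis by (intro eq_vecI) (simp_all add: V_def)
    qed
    ultimately show "\<exists>A. has_velocity 1 V A s \<and> A + \<beta> s \<cdot>\<^sub>v V s + grad 1 f (X s) = 0\<^sub>v 1"
      by blast
  qed
  have grad_t: "grad 1 f (X t) = vec 1 (\<lambda>_. G x0)"
    by (subst grad) (simp_all add: X_def xv)
  have eqs: "X t - 0\<^sub>v 1 = vec 1 (\<lambda>_. x0)" "V t = vec 1 (\<lambda>_. v0)"
    "f (X t) = \<phi> x0" "f (0\<^sub>v 1) = \<phi> 0"
    by (auto simp: X_def V_def xv f_def)
  obtain D where D: "D \<le> 0"
    "((\<lambda>s. lyapunov 1 a P f (0\<^sub>v 1) (X s) (V s) s) has_real_derivative D) (at t)"
    using dec[OF f xs traj t] by blast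
  have "0\<^sub>v 1 \<in> carrier_vec 1" by simp
  from DERIV_unique[OF lyapunov_has_derivative[OF f this traj t P a p11 p12 p22] D(2)] D(1)
  show ?thesis
    unfolding grad_t eqs by (simp add: scalar_prod_def power2_eq_square)
qed

subsection \<open>The matrix inequality\<close>

text \<open>Both directions of the equivalence use the matrix condition only in this polynomial
  form.\<close>

lemma neg_semidef_3_iff:
  "neg_semidef (mat_of_rows_list 3 [[A, B, C], [B, D, E], [C, E, F]]) \<longleftrightarrow>
    (\<forall>x y z. A * x\<^sup>2 + 2 * B * (x * y) + D * y\<^sup>2 + 2 * C * (x * z) + 2 * E * (y * z) + F * z\<^sup>2 \<le> 0)"
    (is "neg_semidef ?M \<longleftrightarrow> (\<forall>x y z. ?q x y z \<le> 0)")
proof -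
  have dims: "dim_row ?M = 3" "dim_col ?M = 3" by (auto simp: mat_of_rows_list_def)
  have "transpose_mat ?M = ?M"
  proof (rule eq_matI)
    fix i j assume "i < dim_row ?M" "j < dim_col ?M"
    then have "i = 0 \<or> i = 1 \<or> i = 2" "j = 0 \<or> j = 1 \<or> j = 2" unfolding dims by auto
    then show "transpose_mat ?M $$ (i, j) = ?M $$ (i, j)"
      by (elim disjE) (simp_all add: mat_of_rows_list_def)
  qed (simp_all add: dims)
  moreover have q: "w \<bullet> (?M *\<^sub>v w) = ?q (w $ 0) (w $ 1) (w $ 2)" if w: "w \<in> carrier_vec 3" for w
  proof -
    have "w \<bullet> (?M *\<^sub>v w) = (\<Sum>i\<in>{0..<3}. w $ i * (\<Sum>j\<in>{0..<3}. ?M $$ (i, j) * w $ j))"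
      using w by (simp add: scalar_prod_def mult_mat_vec_def dims)
    also have "\<dots> = ?q (w $ 0) (w $ 1) (w $ 2)"
      by (simp add: eval_nat_numeral mat_of_rows_list_def) (simp add: power2_eq_square algebra_simps)
    finally show ?thesis .
  qed
  moreover have "?q x y z \<le> 0" if "\<forall>w\<in>carrier_vec 3. ?q (w $ 0) (w $ 1) (w $ 2) \<le> 0" for x y z
  proof -
    have "vec_of_list [x, y, z] \<in> carrier_vec 3" by (simp add: carrier_vecI)
    from bspec[OF that this] show ?thesis by (simp add: numeral_2_eq_2)
  qed
  ultimately show ?thesis
    unfolding neg_semidef_def square_mat.simps dims by (metis (no_types, lifting))
qed

text \<open>Sums the scalar inequality over the coordinates; this is why one 3 by 3 matrix serves
  every dimension.\<close>

lemma neg_semidef_3_vec: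
  assumes "neg_semidef (mat_of_rows_list 3 [[A, B, C], [B, D, E], [C, E, F]])"
    and "x \<in> carrier_vec d" "y \<in> carrier_vec d" "z \<in> carrier_vec d"
  shows "A * (x \<bullet> x) + 2 * B * (x \<bullet> y) + D * (y \<bullet> y) + 2 * C * (x \<bullet> z) + 2 * E * (y \<bullet> z)
    + F * (z \<bullet> z) \<le> 0"
proof -
  have "(\<Sum>i\<in>{0..<d}. A * (x $ i)\<^sup>2 + 2 * B * (x $ i * y $ i) + D * (y $ i)\<^sup>2 + 2 * C * (x $ i * z $ i)
      + 2 * E * (y $ i * z $ i) + F * (z $ i)\<^sup>2) \<le> 0"
    using assms(1) unfolding neg_semidef_3_iff by (intro sum_nonpos) blast
  then show ?thesis
    using assms(2-4) by (simp add: scalar_prod_def sum.distrib sum_distrib_left power2_eq_square)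
qed

section \<open>Consequences of affine inequalities\<close>

lemma affine_nonpos_imp_slope_zero:
  fixes A B :: real
  assumes "\<And>v. A + B * v \<le> 0"
  shows "B = 0"
  \<comment> \<open>For nonzero \<open>B\<close> the expression would equal 1 at this point.\<close>
  using assms[of "(1 - A) / B"] by (cases "B = 0") auto

lemma affine_nonpos_on_ray_imp_slope_nonpos:
  fixes A B :: real
  assumes "\<And>M. M \<ge> 0 \<Longrightarrow> M * A + B \<le> 0"
  shows "A \<le> 0"
proof (rule ccontr)
  assume "\<not> A \<le> 0"
  \<comment> \<open>At this \<open>M\<close> the product \<open>M * A\<close> outweighs
    \<open>B\<close>.\<close>
  then have "\<bar>B\<bar> + 1 + B \<le> 0" using assms[of "(\<bar>B\<bar> + 1) / A"] by simp
  then show False by linarith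
qed

lemma affine_nonpos_near_0_imp_nonpos:
  fixes A B :: real
  assumes "\<And>e. 0 < e \<Longrightarrow> e < 1 \<Longrightarrow> e * A + B \<le> 0"
  shows "B \<le> 0"
proof (rule tendsto_upperbound)
  show "((\<lambda>e. e * A + B) \<longlongrightarrow> B) (at_right 0)"
    by (auto intro!: tendsto_eq_intros)
  show "\<forall>\<^sub>F e in at_right 0. e * A + B \<le> 0"
    by (rule eventually_mono[OF eventually_at_right_real[of 0 1]]) (auto intro: assms)
qed simp

section \<open>The equivalence of dissipation and the matrix inequality\<close>

theorem theorem2p11:
  fixes \<mu> :: real
    and \<beta> a p11 p12 p22 :: "real \<Rightarrow> real"
    and P :: "real \<Rightarrow> real mat"
  assumes "\<mu> \<ge> 0"
    and "continuous_on {0<..} \<beta>"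
    and "\<And>t. t > 0 \<Longrightarrow> \<beta> t \<ge> 0"
    and "a C1_differentiable_on {0<..}"
    and "\<And>t. t > 0 \<Longrightarrow> a t \<ge> 0"
    and "p11 C1_differentiable_on {0<..}"
    and "p12 C1_differentiable_on {0<..}"
    and "p22 C1_differentiable_on {0<..}"
    and "\<And>t. t > 0 \<Longrightarrow> P t = mat_of_rows_list 2 [[p11 t, p12 t], [p12 t, p22 t]]"
    and "\<And>t. t > 0 \<Longrightarrow> pos_semidef (P t)"
  shows
    "(\<forall>d. \<forall>f \<in> strongly_convex_functions d \<mu>.
        \<forall>xs. is_arg_min f (\<lambda>x. x \<in> carrier_vec d) xs \<longrightarrow>
          (\<forall>X V. gradient_flow_trajectory d \<beta> f X V \<longrightarrow>
            (\<forall>t>0. \<exists>D\<le>0. ((\<lambda>s. lyapunov d a P f xs (X s) (V s) s) has_real_derivative D) (at t))))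
     \<longleftrightarrow>
     (\<forall>t>0. \<exists>l1\<ge>0. \<exists>l2\<ge>0.
        neg_semidef (mat_of_rows_list 3
          [[- \<mu> / 2 * (l1 + l2) + deriv p11 t, p11 t - \<beta> t * p12 t + deriv p12 t, - p12 t + l1 / 2],
           [p11 t - \<beta> t * p12 t + deriv p12 t, 2 * (p12 t - \<beta> t * p22 t) + deriv p22 t, - p22 t + a t / 2],
           [- p12 t + l1 / 2, - p22 t + a t / 2, 0]])
        \<and> deriv a t = l1 - l2)"
    (is "?dissipative \<longleftrightarrow> ?LMI")
proof -
  have deriv: "(q has_real_derivative deriv q t) (at t)"
    if "q C1_differentiable_on {0<..}" "t > 0" for q :: "real \<Rightarrow> real" and t
    using that by (simp add: C1_differentiable_on_eq DERIV_deriv_iff_real_differentiable)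
  note derivs = deriv[OF assms(4)] deriv[OF assms(6)] deriv[OF assms(7)] deriv[OF assms(8)]
  show ?thesis
  proof
    assume LMI: ?LMI
    show ?dissipative
    proof (intro allI ballI impI)
      fix d f xs X V and t :: real
      assume f: "f \<in> strongly_convex_functions d \<mu>" and xs: "is_arg_min f (\<lambda>x. x \<in> carrier_vec d) xs"
        and traj: "gradient_flow_trajectory d \<beta> f X V" and t: "t > 0"
      obtain l1 l2 where l: "l1 \<ge> 0" "l2 \<ge> 0" "deriv a t = l1 - l2"
        and M: "neg_semidef (mat_of_rows_list 3
          [[- \<mu> / 2 * (l1 + l2) + deriv p11 t, p11 t - \<beta> t * p12 t + deriv p12 t, - p12 t + l1 / 2],
           [p11 t - \<beta> t * p12 t + deriv p12 t, 2 * (p12 t - \<beta> t * p22 t) + deriv p22 t, - p22 t + a t / 2],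
           [- p12 t + l1 / 2, - p22 t + a t / 2, 0]])"
        using LMI t by blast
      have c: "xs \<in> carrier_vec d" "X t \<in> carrier_vec d" "V t \<in> carrier_vec d"
        using xs traj t by (auto simp: is_arg_min_def gradient_flow_trajectory_def has_velocity_def)
      define y where "y = X t - xs"
      define g where "g = grad d f (X t)"
      have yg: "y \<in> carrier_vec d" "g \<in> carrier_vec d"
        using c f by (auto simp: y_def g_def)
      note bounds = strongly_convex_functions_minimizer_bounds[OF f xs c(2), folded y_def g_def]
      \<comment> \<open>Their combination bounds \<open>deriv a t * (f (X t) - f xs)\<close> by
        scalar products alone, since \<open>deriv a t\<close> is \<open>l1 - l2\<close>; the matrix
        inequality at \<open>y\<close>, \<open>V t\<close> and \<open>g\<close> then
        applies.\<close>
      have "l1 * (f (X t) - f xs) \<le> l1 * (y \<bullet> g - \<mu> / 2 * (y \<bullet> y))"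
        "l2 * (\<mu> / 2 * (y \<bullet> y)) \<le> l2 * (f (X t) - f xs)"
        by (rule mult_left_mono[OF bounds(1) l(1)], rule mult_left_mono[OF bounds(2) l(2)])
      then have "deriv a t * (f (X t) - f xs) \<le> l1 * (y \<bullet> g) - \<mu> / 2 * (l1 + l2) * (y \<bullet> y)"
        unfolding l(3) by (simp add: algebra_simps add_divide_distrib)
      then have "deriv a t * (f (X t) - f xs) + deriv p11 t * (y \<bullet> y)
          + 2 * (p11 t - \<beta> t * p12 t + deriv p12 t) * (y \<bullet> V t)
          + (2 * (p12 t - \<beta> t * p22 t) + deriv p22 t) * (V t \<bullet> V t)
          - 2 * p12 t * (y \<bullet> g) + (a t - 2 * p22 t) * (V t \<bullet> g) \<le> 0"
        using neg_semidef_3_vec[OF M yg(1) c(3) yg(2)] by (simp add: algebra_simps add_divide_distrib)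
      then show "\<exists>D\<le>0. ((\<lambda>s. lyapunov d a P f xs (X s) (V s) s) has_real_derivative D) (at t)"
        using lyapunov_has_derivative[OF f c(1) traj t assms(9) derivs[OF t]]
        unfolding y_def g_def by blast
    qed
  next
    assume dissipative: ?dissipative
    show ?LMI
    proof (intro allI impI)
      fix t :: real assume t: "t > 0"
      define a' where "a' = deriv a t"
      define q where "q = p11 t - \<beta> t * p12 t + deriv p12 t"
      define r where "r = 2 * (p12 t - \<beta> t * p22 t) + deriv p22 t"
      \<comment> \<open>For \<open>c + e \<le> 1\<close> the slope of \<open>\<psi> c e\<close> at \<open>1\<close> is \<open>e\<close>, and \<open>\<psi> c e 1 / e\<close> tends to \<open>0\<close> if
        \<open>c = 1 - e\<close> and to \<open>1\<close> if \<open>c = 0\<close>, as \<open>e\<close> tends to \<open>0\<close>: the two extreme values that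
        convexity allows.\<close>
      define \<psi> where "\<psi> c e x = ((max 0 (x - c))\<^sup>2 - (max 0 (x - c - e))\<^sup>2) / 2" for c e x :: real
      define k where "k c e x = max 0 (min e (x - c))" for c e x :: real
      \<comment> \<open>The pointwise inequality for the test functions: \<open>M\<close> scales the
        ramp, \<open>c\<close> is where it starts, and \<open>e\<close> is its height.\<close>
      have key: "a' * (\<mu> / 2 * x\<^sup>2 + M * \<psi> c e x) + deriv p11 t * x\<^sup>2 + 2 * q * (x * v) + r * v\<^sup>2
          - 2 * p12 t * (x * (\<mu> * x + M * k c e x)) + (a t - 2 * p22 t) * (v * (\<mu> * x + M * k c e x)) \<le> 0"
        if "M \<ge> 0" "e \<ge> 0" "c \<ge> 0" for M c e x v :: real
      proof -
        define \<phi> where "\<phi> y = \<mu> / 2 * y\<^sup>2 + M * \<psi> c e y" for y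
        define G where "G y = \<mu> * y + M * k c e y" for y
        note ramp = ramp_antiderivative[OF \<open>e \<ge> 0\<close>, where c = c, folded \<psi>_def k_def]
        have G: "(\<phi> has_real_derivative G y) (at y)" for y
          unfolding \<phi>_def G_def by (auto intro!: derivative_eq_intros ramp(1))
        have lip: "\<bar>G y - G z\<bar> \<le> (\<mu> + M) * \<bar>y - z\<bar>" for y z
        proof -
          have "G y - G z = \<mu> * (y - z) + M * (k c e y - k c e z)"
            by (simp add: G_def algebra_simps)
          then have "\<bar>G y - G z\<bar> \<le> \<bar>\<mu> * (y - z)\<bar> + \<bar>M * (k c e y - k c e z)\<bar>"
            using abs_triangle_ineq by simp
          also have "\<dots> = \<mu> * \<bar>y - z\<bar> + M * \<bar>k c e y - k c e z\<bar>"
            using assms(1) \<open>M \<ge> 0\<close> by (simp add: abs_mult)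
          also have "\<dots> \<le> \<mu> * \<bar>y - z\<bar> + M * \<bar>y - z\<bar>"
            using \<open>M \<ge> 0\<close> by (intro add_left_mono mult_left_mono) (auto simp: k_def)
          finally show ?thesis by (simp add: algebra_simps)
        qed
        \<comment> \<open>The quadratic part satisfies this with equality; the ramp part contributes
          its tangent inequality multiplied by \<open>M\<close>.\<close>
        have conv: "\<phi> y + G y * (z - y) + \<mu> / 2 * (z - y)\<^sup>2 \<le> \<phi> z" for y z
          using mult_left_mono[OF ramp(2)[where x = z and y = y] \<open>M \<ge> 0\<close>]
          by (simp add: \<phi>_def G_def power2_eq_square field_simps)
        \<comment> \<open>Since \<open>c\<close> is nonnegative the ramp has not started at 0, which
          keeps 0 a critical point.\<close>
        have \<phi>0: "\<phi> 0 = 0" and G0: "G 0 = 0"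
          using that by (auto simp: \<phi>_def G_def \<psi>_def k_def)
        have min: "\<phi> 0 \<le> \<phi> y" for y
        proof -
          have "0 \<le> \<mu> / 2 * (y - 0)\<^sup>2" using assms(1) by simp
          then show ?thesis using conv[of 0 y] by (simp add: G0)
        qed
        have "a' * (\<phi> x - \<phi> 0) + deriv p11 t * x\<^sup>2 + 2 * q * (x * v) + r * v\<^sup>2
            - 2 * p12 t * (x * G x) + (a t - 2 * p22 t) * (v * G x) \<le> 0"
          unfolding a'_def q_def r_def
          by (rule lyapunov_inequality_1[OF _ assms(2) t assms(9) derivs[OF t] G lip conv min])
            (use dissipative in blast)
        then show ?thesis by (simp add: \<phi>0) (simp add: \<phi>_def G_def)
      qed
      \<comment> \<open>At \<open>x = 1\<close> the inequality \<open>key\<close> is affine in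
        \<open>M\<close>; letting \<open>M\<close> grow leaves only the coefficient of
        \<open>M\<close>.\<close>
      have ramp_ineq: "(a' * \<psi> c e 1 - 2 * p12 t * e) + (a t - 2 * p22 t) * e * v \<le> 0"
        if "0 \<le> e" "0 \<le> c" "c + e \<le> 1" for c e v
      proof (rule affine_nonpos_on_ray_imp_slope_nonpos)
        fix M :: real assume "M \<ge> 0"
        have "k c e 1 = e" using that by (simp add: k_def)
        then show "M * ((a' * \<psi> c e 1 - 2 * p12 t * e) + (a t - 2 * p22 t) * e * v)
            + (a' * (\<mu> / 2) + deriv p11 t + 2 * q * v + r * v\<^sup>2 - 2 * p12 t * \<mu>
              + (a t - 2 * p22 t) * (v * \<mu>)) \<le> 0"
          using key[OF \<open>M \<ge> 0\<close> that(1,2), of 1 v] by (simp add: algebra_simps)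
      qed
      \<comment> \<open>For \<open>c = 0\<close> and \<open>e = 1\<close> the inequality is affine
        in the arbitrary velocity \<open>v\<close>, so its slope in \<open>v\<close>
        vanishes.\<close>
      have "(a t - 2 * p22 t) * 1 = 0"
        by (rule affine_nonpos_imp_slope_zero[OF ramp_ineq[of 1 0]]) auto
      then have p22: "a t = 2 * p22 t" by simp
      have "- 2 * p12 t \<le> 0"
      proof (rule affine_nonpos_near_0_imp_nonpos)
        fix e :: real assume e: "0 < e" "e < 1"
        \<comment> \<open>Here \<open>\<psi> (1 - e) e 1\<close> is \<open>e * e / 2\<close>, of
          second order in \<open>e\<close>, so \<open>a'\<close> drops out in the limit after
          division by \<open>e\<close>.\<close>
        have "e * (e * (a' / 2) + - 2 * p12 t) \<le> 0"
          using ramp_ineq[of e "1 - e" 0] e by (simp add: \<psi>_def power2_eq_square algebra_simps)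
        then show "e * (a' / 2) + - 2 * p12 t \<le> 0"
          using e by (simp add: mult_le_0_iff)
      qed
      then have p12: "p12 t \<ge> 0" by simp
      have "a' - 2 * p12 t \<le> 0"
      proof (rule affine_nonpos_near_0_imp_nonpos)
        fix e :: real assume e: "0 < e" "e < 1"
        \<comment> \<open>Here \<open>\<psi> 0 e 1\<close> is \<open>e - e * e / 2\<close>, so
          \<open>a'\<close> survives the division by \<open>e\<close> and the limit.\<close>
        have "e * (e * (- a' / 2) + (a' - 2 * p12 t)) \<le> 0"
          using ramp_ineq[of e 0 0] e by (simp add: \<psi>_def power2_eq_square field_simps)
        then show "e * (- a' / 2) + (a' - 2 * p12 t) \<le> 0"
          using e by (simp add: mult_le_0_iff)
      qed
      then have l2: "2 * p12 t - a' \<ge> 0" by simp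
      \<comment> \<open>The case \<open>M = 0\<close>, the pure quadratic. The multipliers are
        \<open>l1 = 2 * p12 t\<close>, which annihilates the corner entries, and
        \<open>l2 = 2 * p12 t - a'\<close>, which \<open>deriv a t = l1 - l2\<close> then dictates.
        With them and \<open>a t = 2 * p22 t\<close>, the last row and column vanish.\<close>
      have "(- \<mu> / 2 * (2 * p12 t + (2 * p12 t - a')) + deriv p11 t) * x\<^sup>2 + 2 * q * (x * v) + r * v\<^sup>2 \<le> 0"
        for x v
        using key[of 0 0 0 x v] by (simp add: p22 power2_eq_square algebra_simps)
      then have "neg_semidef (mat_of_rows_list 3
          [[- \<mu> / 2 * (2 * p12 t + (2 * p12 t - a')) + deriv p11 t, q, - p12 t + 2 * p12 t / 2],
           [q, r, - p22 t + a t / 2], [- p12 t + 2 * p12 t / 2, - p22 t + a t / 2, 0]])"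
        unfolding neg_semidef_3_iff by (simp add: p22)
      moreover have "deriv a t = 2 * p12 t - (2 * p12 t - a')" by (simp add: a'_def)
      ultimately show "\<exists>l1\<ge>0. \<exists>l2\<ge>0.
        neg_semidef (mat_of_rows_list 3
          [[- \<mu> / 2 * (l1 + l2) + deriv p11 t, p11 t - \<beta> t * p12 t + deriv p12 t, - p12 t + l1 / 2],
           [p11 t - \<beta> t * p12 t + deriv p12 t, 2 * (p12 t - \<beta> t * p22 t) + deriv p22 t, - p22 t + a t / 2],
           [- p12 t + l1 / 2, - p22 t + a t / 2, 0]])
        \<and> deriv a t = l1 - l2"
        unfolding q_def r_def using p12 l2 by (intro exI[of _ "2 * p12 t"] exI[of _ "2 * p12 t - a'"] conjI) auto
    qed
  qed
qed

end
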